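(* Let $G$ be a graph on $n$ vertices with a proper edge-coloring. If $G$ has at least $32n\log^2(5n)$ edges, then $G$ contains a rainbow cycle.
   Context: A proper edge-coloring assigns colors to edges so that any two edges sharing a vertex receive different colors. A subgraph is rainbow if all of its edges receive distinct colors. Here $\log$ denotes the base-$2$ logarithm. *)

theory Defs
  imports Complex_Main
begin

definition simple_graph :: "'a set \<Rightarrow> 'a set set \<Rightarrow> bool" where
  "simple_graph V E \<longleftrightarrow> finite V \<and> (\<forall>e\<in>E. e \<subseteq> V \<and> card e = 2)"

definition proper_edge_coloring :: "'a set set \<Rightarrow> ('a set \<Rightarrow> 'c) \<Rightarrow> bool" where
  "proper_edge_coloring E c \<longleftrightarrow>
     (\<forall>e\<in>E. \<forall>f\<in>E. e \<noteq> f \<and> e \<inter> f \<noteq> {} \<longrightarrow> c e \<noteq> c f)"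

text \<open>The edges joining cyclically consecutive vertices of a list (last and first included).\<close>

definition cycle_edges :: "'a list \<Rightarrow> 'a set set" where
  "cycle_edges vs = {{vs ! i, vs ! (Suc i mod length vs)} | i. i < length vs}"

definition is_cycle :: "'a set set \<Rightarrow> 'a list \<Rightarrow> bool" where
  "is_cycle E vs \<longleftrightarrow> length vs \<ge> 3 \<and> distinct vs \<and> cycle_edges vs \<subseteq> E"

definition rainbow :: "('a set \<Rightarrow> 'c) \<Rightarrow> 'a set set \<Rightarrow> bool" where
  "rainbow c F \<longleftrightarrow> inj_on c F"

end

theory Submission
  imports Defs "HOL-Analysis.Convex"
begin

text \<open>
  Pass to a subgraph of minimum degree at least \<open>D = 32 log\<^sup>2 (5n)\<close> and let \<open>M\<close> be its normalised
  adjacency matrix, with entry \<open>1 / sqrt (d(u) d(v))\<close> at each edge; let \<open>M\<^sub>g\<close> be the part of \<open>M\<close> on the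
  edges of colour \<open>g\<close>. As \<open>M\<close> fixes the vector \<open>sqrt d\<close>, we have \<open>tr M\<^sup>2\<^sup>k \<ge> 1\<close> for all \<open>k\<close>. This trace
  is a weighted count of closed walks of length \<open>2k\<close>. Without rainbow closed walks each of them
  repeats a colour, so the trace is at most a sum of fewer than \<open>4k\<^sup>2\<close> terms
  \<open>\<Sum>\<^sub>g tr (M\<^sub>g M\<^sup>a M\<^sub>g M\<^sup>b)\<close> with \<open>a + b = 2k - 2\<close>. By convexity in \<open>a\<close> each term is at most
  \<open>\<Sum>\<^sub>g tr (M\<^sub>g\<^sup>2 M\<^sup>2\<^sup>k\<^sup>-\<^sup>2)\<close>, and since the colouring is proper, \<open>\<Sum>\<^sub>g M\<^sub>g\<^sup>2\<close> is diagonal with entries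
  at most \<open>1/D\<close>. Hence \<open>tr M\<^sup>2\<^sup>k \<le> (4k\<^sup>2/D) tr M\<^sup>2\<^sup>k\<^sup>-\<^sup>2\<close>, so the trace halves at each step up to
  \<open>k \<approx> log n\<close> and drops from at most \<open>n\<close> to below \<open>1\<close>, a contradiction. Finally, a shortest
  closed segment of a rainbow closed walk is a rainbow cycle.
\<close>

subsection \<open>Matrices indexed by a finite set\<close>

lemma sum_swap_pairs:
  "(\<Sum>u\<in>A. \<Sum>v\<in>B. \<Sum>x\<in>C. \<Sum>y\<in>F. f u v x y)
    = (\<Sum>x\<in>C. \<Sum>y\<in>F. \<Sum>u\<in>A. \<Sum>v\<in>B. f u v x y :: real)"
proof -
  have "(\<Sum>u\<in>A. \<Sum>v\<in>B. \<Sum>x\<in>C. \<Sum>y\<in>F. f u v x y)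
      = (\<Sum>u\<in>A. \<Sum>x\<in>C. \<Sum>v\<in>B. \<Sum>y\<in>F. f u v x y)"
    by (rule sum.cong[OF refl sum.swap])
  also have "\<dots> = (\<Sum>x\<in>C. \<Sum>u\<in>A. \<Sum>v\<in>B. \<Sum>y\<in>F. f u v x y)"
    by (rule sum.swap)
  also have "\<dots> = (\<Sum>x\<in>C. \<Sum>u\<in>A. \<Sum>y\<in>F. \<Sum>v\<in>B. f u v x y)"
    by (rule sum.cong[OF refl sum.cong[OF refl sum.swap]])
  also have "\<dots> = (\<Sum>x\<in>C. \<Sum>y\<in>F. \<Sum>u\<in>A. \<Sum>v\<in>B. f u v x y)"
    by (rule sum.cong[OF refl sum.swap])
  finally show ?thesis .
qed

locale finite_index =
  fixes V :: "'a set"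
  assumes fin: "finite V"
begin

definition mm :: "('a \<Rightarrow> 'a \<Rightarrow> real) \<Rightarrow> ('a \<Rightarrow> 'a \<Rightarrow> real) \<Rightarrow> 'a \<Rightarrow> 'a \<Rightarrow> real" where
  "mm X Y = (\<lambda>u w. \<Sum>v\<in>V. X u v * Y v w)"

definition mI :: "'a \<Rightarrow> 'a \<Rightarrow> real" where
  "mI = (\<lambda>u v. of_bool (u = v \<and> u \<in> V))"

definition tp :: "('a \<Rightarrow> 'a \<Rightarrow> real) \<Rightarrow> 'a \<Rightarrow> 'a \<Rightarrow> real" where
  "tp X = (\<lambda>u v. X v u)"

definition tr :: "('a \<Rightarrow> 'a \<Rightarrow> real) \<Rightarrow> real" where
  "tr X = (\<Sum>v\<in>V. X v v)"

text \<open>Matrices are total functions on the whole type. Since the diagonal of \<open>mI\<close>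
  stops at \<open>V\<close>, it is a unit only for matrices that vanish off
  \<open>V\<close>.\<close>

definition supp :: "('a \<Rightarrow> 'a \<Rightarrow> real) \<Rightarrow> bool" where
  "supp X \<longleftrightarrow> (\<forall>u v. X u v \<noteq> 0 \<longrightarrow> u \<in> V \<and> v \<in> V)"

fun mprod :: "('a \<Rightarrow> 'a \<Rightarrow> real) list \<Rightarrow> 'a \<Rightarrow> 'a \<Rightarrow> real" where
  "mprod [] = mI"
| "mprod (X # Xs) = mm X (mprod Xs)"

definition mpow :: "('a \<Rightarrow> 'a \<Rightarrow> real) \<Rightarrow> nat \<Rightarrow> 'a \<Rightarrow> 'a \<Rightarrow> real" where
  "mpow X k = mprod (replicate k X)"

lemma mm_assoc: "mm (mm X Y) Z = mm X (mm Y Z)"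
proof (intro ext)
  fix u w
  have "mm (mm X Y) Z u w = (\<Sum>v\<in>V. \<Sum>t\<in>V. X u t * Y t v * Z v w)"
    by (simp add: mm_def sum_distrib_right)
  also have "\<dots> = (\<Sum>t\<in>V. \<Sum>v\<in>V. X u t * Y t v * Z v w)"
    by (rule sum.swap)
  also have "\<dots> = mm X (mm Y Z) u w"
    by (simp add: mm_def sum_distrib_left mult.assoc)
  finally show "mm (mm X Y) Z u w = mm X (mm Y Z) u w" .
qed

lemma tr_mm_commute: "tr (mm X Y) = tr (mm Y X)"
  unfolding tr_def mm_def by (subst sum.swap) (simp add: mult.commute)

lemma mm_mI_left:
  assumes "supp X"
  shows "mm mI X = X"
proof (intro ext)
  fix u w
  have "mm mI X u w = (\<Sum>v\<in>V. if v = u then X u w else 0)"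
    unfolding mm_def by (intro sum.cong) (auto simp: mI_def)
  also have "\<dots> = X u w"
    using assms by (auto simp: fin supp_def)
  finally show "mm mI X u w = X u w" .
qed

lemma mm_mI_right:
  assumes "supp X"
  shows "mm X mI = X"
proof (intro ext)
  fix u w
  have "mm X mI u w = (\<Sum>v\<in>V. if v = w then X u w else 0)"
    unfolding mm_def by (intro sum.cong) (auto simp: mI_def)
  also have "\<dots> = X u w"
    using assms by (auto simp: fin supp_def)
  finally show "mm X mI u w = X u w" .
qed

lemma supp_mm:
  assumes "supp X" "supp Y"
  shows "supp (mm X Y)"
  unfolding supp_def
proof (intro allI impI)
  fix u w assume "mm X Y u w \<noteq> 0"
  then obtain v where "X u v * Y v w \<noteq> 0"
    unfolding mm_def by (meson sum.not_neutral_contains_not_neutral)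
  then show "u \<in> V \<and> w \<in> V" using assms by (auto simp: supp_def)
qed

lemma supp_mprod: "(\<And>X. X \<in> set Xs \<Longrightarrow> supp X) \<Longrightarrow> supp (mprod Xs)"
  by (induction Xs) (auto simp: supp_mm, auto simp: supp_def mI_def split: if_splits)

lemma mprod_append:
  "(\<And>X. X \<in> set Ys \<Longrightarrow> supp X) \<Longrightarrow> mprod (Xs @ Ys) = mm (mprod Xs) (mprod Ys)"
  by (induction Xs) (auto simp: mm_assoc mm_mI_left supp_mprod)

lemma mpow_0 [simp]: "mpow X 0 = mI"
  by (simp add: mpow_def)

lemma mpow_Suc: "mpow X (Suc k) = mm X (mpow X k)"
  by (simp add: mpow_def)

lemma supp_mpow: "supp X \<Longrightarrow> supp (mpow X k)"
  unfolding mpow_def by (rule supp_mprod) auto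

lemma mpow_add: "supp X \<Longrightarrow> mpow X (j + k) = mm (mpow X j) (mpow X k)"
  unfolding mpow_def replicate_add by (rule mprod_append) auto

lemma mpow_Suc2:
  assumes "supp X"
  shows "mpow X (Suc k) = mm (mpow X k) X"
  using mpow_add[OF assms, of k 1] assms by (simp add: mpow_Suc mm_mI_right)

lemma tp_mm: "tp (mm X Y) = mm (tp Y) (tp X)"
  by (simp add: tp_def mm_def mult.commute)

lemma tp_mpow:
  assumes "supp X" and "tp X = X"
  shows "tp (mpow X k) = mpow X k"
proof (induction k)
  case 0
  show ?case by (auto simp: tp_def mI_def fun_eq_iff)
next
  case (Suc k)
  have "tp (mpow X (Suc k)) = mm (mpow X k) X"
    by (simp add: mpow_Suc tp_mm assms(2) Suc)
  then show ?case by (simp add: mpow_Suc2[OF assms(1)])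
qed

lemma mpow_nonneg:
  assumes "\<And>u v. 0 \<le> X u v"
  shows "0 \<le> mpow X k u v"
  by (induction k arbitrary: u v)
    (auto simp: mI_def mpow_Suc mm_def assms intro!: sum_nonneg)

section \<open>Traces of products and powers\<close>

lemma tr_mI: "tr mI = card V"
  by (simp add: tr_def mI_def)

text \<open>Entrywise AM-GM; the right side is the sum of the squared Frobenius norms of
  \<open>X\<close> and \<open>Y\<close>.\<close>

lemma tr_mm_le: "2 * tr (mm X Y) \<le> tr (mm X (tp X)) + tr (mm (tp Y) Y)"
proof -
  have "2 * tr (mm X Y) = (\<Sum>u\<in>V. \<Sum>v\<in>V. 2 * (X u v * Y v u))"
    by (simp add: tr_def mm_def sum_distrib_left)
  also have "\<dots> \<le> (\<Sum>u\<in>V. \<Sum>v\<in>V. X u v * X u v + Y v u * Y v u)"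
  proof (intro sum_mono)
    fix u v
    show "2 * (X u v * Y v u) \<le> X u v * X u v + Y v u * Y v u"
      using sum_squares_bound[of "X u v" "Y v u"] by (simp add: power2_eq_square)
  qed
  also have "\<dots> = tr (mm X (tp X)) + tr (mm (tp Y) Y)"
    by (simp add: tr_def mm_def tp_def sum.distrib)
  finally show ?thesis .
qed

text \<open>The trace on the left is midpoint convex in \<open>a\<close> on even arguments and symmetric under
  swapping \<open>a\<close> and \<open>b\<close>, so it is largest at the end points.\<close>

lemma tr_sandwich_le:
  assumes M: "supp M" "tp M = M"
    and B: "supp B" "tp B = B"
    and ab: "a + b = 2 * m"
  shows "tr (mm B (mm (mpow M a) (mm B (mpow M b)))) \<le> tr (mm (mm B B) (mpow M (2 * m)))"
proof -
  define f where "f a b = tr (mm B (mm (mpow M a) (mm B (mpow M b))))" for a b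
  \<comment> \<open>The cyclic word is cut into two halves with one \<open>B\<close> each;
    transposing a half swaps its exponents.\<close>
  define Z where "Z p q = mm (mpow M p) (mm B (mpow M q))" for p q
  have Zt: "tp (Z p q) = Z q p" for p q
    by (simp add: Z_def tp_mm tp_mpow M B(2) mm_assoc)
  have ZZ: "tr (mm (Z p q) (Z r s)) = f (q + r) (s + p)" for p q r s
  proof -
    have "tr (mm (Z p q) (Z r s))
        = tr (mm (mpow M p) (mm B (mm (mpow M (q + r)) (mm B (mpow M s)))))"
      by (simp add: Z_def mpow_add[OF M(1)] mm_assoc)
    also have "\<dots> = f (q + r) (s + p)"
      by (subst tr_mm_commute) (simp add: f_def mpow_add[OF M(1)] mm_assoc)
    finally show ?thesis .
  qed
  \<comment> \<open>\<open>tr_mm_le\<close> pairs each half with its own transpose, so doubled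
    exponents appear on the right.\<close>
  have conv: "2 * f (q + r) (s + p) \<le> f (2 * q) (2 * p) + f (2 * r) (2 * s)" for p q r s
    using tr_mm_le[of "Z p q" "Z r s"] unfolding Zt ZZ by (simp flip: mult_2)
  have f_commute: "f a b = f b a" for a b
    unfolding f_def using tr_mm_commute[of "mm B (mpow M a)" "mm B (mpow M b)"]
    by (simp add: mm_assoc)
  define g where "g q = f (2 * q) (2 * (m - q))" for q
  have conv': "2 * f (q + r) (2 * m - (q + r)) \<le> g q + g r" if "q \<le> m" "r \<le> m" for q r
  proof -
    have "m - r + (m - q) = 2 * m - (q + r)" using that by simp
    then show ?thesis
      using conv[of q r "m - r" "m - q"] by (simp add: g_def)
  qed
  have g_m: "g m = g 0"
    by (simp add: g_def f_commute[of "2 * m"])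
  have "Max (g ` {..m}) \<in> g ` {..m}"
    by (intro Max_in) auto
  then obtain q0 where q0: "q0 \<le> m" "Max (g ` {..m}) = g q0"
    by (elim imageE) simp
  have q0_max: "g q \<le> g q0" if "q \<le> m" for q
    unfolding q0(2)[symmetric] using that by (intro Max_ge) auto
  \<comment> \<open>The maximiser \<open>q0\<close> is the midpoint of an end point and another
    index: of \<open>0\<close> and \<open>2 * q0\<close>, or of \<open>m\<close> and
    \<open>2 * q0 - m\<close>. Convexity then forces the maximum down to the common end
    value.\<close>
  have "g q0 \<le> g 0"
  proof (cases "2 * q0 \<le> m")
    case True
    have "2 * g q0 \<le> g 0 + g (2 * q0)"
      using conv'[of 0 "2 * q0"] True by (simp add: g_def diff_mult_distrib2)
    then show ?thesis using q0_max[OF True] by linarith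
  next
    case False
    then have "2 * q0 - m \<le> m" using q0(1) by linarith
    moreover have "2 * g q0 \<le> g m + g (2 * q0 - m)"
      using conv'[of m "2 * q0 - m"] False \<open>2 * q0 - m \<le> m\<close> by (simp add: g_def diff_mult_distrib2)
    ultimately show ?thesis using q0_max[of "2 * q0 - m"] g_m by linarith
  qed
  then have g_le: "g q \<le> g 0" if "q \<le> m" for q
    using q0_max[OF that] by linarith
  \<comment> \<open>This covers odd \<open>a\<close> too: its value is bounded by the mean of two
    even samples.\<close>
  obtain q r where qr: "q \<le> m" "r \<le> m" "a = q + r"
  proof
    show "min a m \<le> m" "a - min a m \<le> m" "a = min a m + (a - min a m)"
      using ab by (auto simp: min_def)
  qed
  have "2 * f a b \<le> g q + g r"
  proof -
    have "2 * m - (q + r) = b" using ab qr(3) by linarith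
    then show ?thesis using conv'[OF qr(1,2)] qr(3) by simp
  qed
  then have "f a b \<le> g 0"
    using g_le[OF qr(1)] g_le[OF qr(2)] by linarith
  also have "g 0 = tr (mm (mm B B) (mpow M (2 * m)))"
    by (simp add: g_def f_def mm_mI_left supp_mm B(1) supp_mpow[OF M(1)] mm_assoc)
  finally show ?thesis unfolding f_def .
qed

text \<open>No spectral theorem is needed: \<open>mpow M k\<close> fixes \<open>s\<close>,
  Cauchy-Schwarz in each row bounds the norm of the image by the Frobenius norm, and by symmetry the
  square of the latter is \<open>tr (mpow M (2 * k))\<close>.\<close>

lemma tr_mpow_ge_1:
  assumes M: "supp M" "tp M = M"
    and s: "\<And>u. u \<in> V \<Longrightarrow> (\<Sum>v\<in>V. M u v * s v) = s u"
    and pos: "(\<Sum>v\<in>V. (s v)\<^sup>2) > 0"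
  shows "1 \<le> tr (mpow M (2 * k))"
proof -
  have eig: "(\<Sum>v\<in>V. mpow M k u v * s v) = s u" if "u \<in> V" for u
    using that
  proof (induction k arbitrary: u)
    case 0
    then show ?case by (simp add: mI_def fin of_bool_def if_distribR if_distrib cong: if_cong)
  next
    case (Suc k)
    have "(\<Sum>v\<in>V. mpow M (Suc k) u v * s v) = (\<Sum>v\<in>V. \<Sum>t\<in>V. M u t * (mpow M k t v * s v))"
      by (simp add: mpow_Suc mm_def sum_distrib_right mult.assoc)
    also have "\<dots> = (\<Sum>t\<in>V. M u t * (\<Sum>v\<in>V. mpow M k t v * s v))"
      by (subst sum.swap) (simp add: sum_distrib_left)
    also have "\<dots> = s u"
      using Suc s by simp
    finally show ?case .
  qed
  have "(\<Sum>u\<in>V. (s u)\<^sup>2) = (\<Sum>u\<in>V. (\<Sum>v\<in>V. mpow M k u v * s v)\<^sup>2)"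
    using eig by simp
  also have "\<dots> \<le> (\<Sum>u\<in>V. (\<Sum>v\<in>V. (mpow M k u v)\<^sup>2) * (\<Sum>v\<in>V. (s v)\<^sup>2))"
    by (intro sum_mono Cauchy_Schwarz_ineq_sum)
  also have "\<dots> = tr (mpow M (2 * k)) * (\<Sum>v\<in>V. (s v)\<^sup>2)"
  proof -
    have "tr (mpow M (2 * k)) = tr (mm (mpow M k) (tp (mpow M k)))"
      by (simp only: mult_2 mpow_add[OF M(1)] tp_mpow[OF M])
    then show ?thesis
      by (simp add: tr_def tp_def mm_def sum_distrib_right power2_eq_square)
  qed
  finally show ?thesis using pos by simp
qed

section \<open>Expanding matrix products over walks\<close>

definition walks :: "nat \<Rightarrow> 'a list set" where
  "walks l = {vs. set vs \<subseteq> V \<and> length vs = l}"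

text \<open>Walks are arbitrary vertex lists; adjacency is enforced only by vanishing weights. A
  list \<open>vs\<close> needs one more vertex than \<open>Xs\<close> has factors, hence the
  separate start in \<open>u # vs\<close> below.\<close>

definition wt :: "('a \<Rightarrow> 'a \<Rightarrow> real) list \<Rightarrow> 'a list \<Rightarrow> real" where
  "wt Xs vs = (\<Prod>t<length Xs. (Xs ! t) (vs ! t) (vs ! Suc t))"

lemma sum_walks_Suc: "(\<Sum>vs\<in>walks (Suc l). F vs) = (\<Sum>v\<in>V. \<Sum>vs\<in>walks l. F (v # vs))"
proof -
  have "walks (Suc l) = (\<lambda>(v, vs). v # vs) ` (V \<times> walks l)"
    by (auto simp: walks_def image_iff length_Suc_conv)
  moreover have "inj_on (\<lambda>(v, vs). v # vs) (V \<times> walks l)"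
    by (auto simp: inj_on_def)
  ultimately show ?thesis
    by (simp add: sum.reindex case_prod_unfold sum.cartesian_product)
qed

lemma wt_Cons: "wt (X # Xs) (u # v # vs) = X u v * wt Xs (v # vs)"
  unfolding wt_def by (simp add: prod.lessThan_Suc_shift del: prod.lessThan_Suc)

lemma mprod_eq_sum_walks:
  "u \<in> V \<Longrightarrow> mprod Xs u w
    = (\<Sum>vs\<in>walks (length Xs). wt Xs (u # vs) * of_bool (last (u # vs) = w))"
proof (induction Xs arbitrary: u)
  case Nil
  have "walks 0 = {[]}" by (auto simp: walks_def)
  then show ?case using Nil by (simp add: mI_def wt_def)
next
  case (Cons X Xs)
  have "mprod (X # Xs) u w = (\<Sum>v\<in>V. X u v *
      (\<Sum>vs\<in>walks (length Xs). wt Xs (v # vs) * of_bool (last (v # vs) = w)))"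
    using Cons.IH by (simp add: mm_def)
  also have "\<dots> = (\<Sum>vs\<in>walks (length (X # Xs)).
      wt (X # Xs) (u # vs) * of_bool (last (u # vs) = w))"
    by (simp add: sum_walks_Suc wt_Cons sum_distrib_left mult.assoc)
  finally show ?case .
qed

lemma tr_mprod_eq_sum_walks:
  "tr (mprod Xs) = (\<Sum>u\<in>V. \<Sum>vs\<in>walks (length Xs).
     wt Xs (u # vs) * of_bool (last (u # vs) = u))"
  unfolding tr_def by (intro sum.cong refl mprod_eq_sum_walks)

end

subsection \<open>Rainbow closed walks\<close>

locale min_degree_graph = finite_index V for V :: "'a set" +
  fixes E :: "'a set set" and c :: "'a set \<Rightarrow> 'c" and D :: real
  assumes simple: "simple_graph V E"
    and proper: "proper_edge_coloring E c"
    and nonempty: "V \<noteq> {}"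
    and D_pos: "D > 0"
    and min_deg: "\<And>v. v \<in> V \<Longrightarrow> D \<le> real (card {w. {v, w} \<in> E})"
begin

section \<open>The normalised adjacency matrix and its colour classes\<close>

definition dg :: "'a \<Rightarrow> real" where
  "dg u = real (card {w. {u, w} \<in> E})"

definition adj :: "'a \<Rightarrow> 'a \<Rightarrow> real" where
  "adj u v = of_bool ({u, v} \<in> E) / (sqrt (dg u) * sqrt (dg v))"

definition cadj :: "'c \<Rightarrow> 'a \<Rightarrow> 'a \<Rightarrow> real" where
  "cadj g u v = of_bool (c {u, v} = g) * adj u v"

lemma edge_in_V: "{u, v} \<in> E \<Longrightarrow> u \<in> V \<and> v \<in> V"
  using simple by (auto simp: simple_graph_def)

lemma finite_E: "finite E"
  using simple finite_subset[of E "Pow V"] by (auto simp: simple_graph_def)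

lemma dg_ge: "u \<in> V \<Longrightarrow> D \<le> dg u"
  unfolding dg_def by (rule min_deg)

lemma dg_pos: "u \<in> V \<Longrightarrow> 0 < dg u"
  using dg_ge[of u] D_pos by linarith

lemma dg_nonneg: "0 \<le> dg u"
  by (simp add: dg_def)

lemma dg_eq_sum: "dg u = (\<Sum>v\<in>V. of_bool ({u, v} \<in> E))"
proof -
  have "V \<inter> {v. {u, v} \<in> E} = {v. {u, v} \<in> E}"
    using edge_in_V by blast
  then show ?thesis by (simp add: dg_def fin)
qed

lemma adj_sym: "adj u v = adj v u"
  by (simp add: adj_def insert_commute mult.commute)

lemma cadj_sym: "cadj g u v = cadj g v u"
  by (simp add: cadj_def insert_commute adj_sym)

lemma tp_adj: "tp adj = adj"
  unfolding tp_def by (intro ext adj_sym)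

lemma tp_cadj: "tp (cadj g) = cadj g"
  unfolding tp_def by (intro ext cadj_sym)

lemma adj_nonneg: "0 \<le> adj u v"
  by (simp add: adj_def dg_nonneg)

lemma cadj_nonneg: "0 \<le> cadj g u v"
  by (simp add: cadj_def adj_nonneg)

lemma adj_edge: "adj u v \<noteq> 0 \<Longrightarrow> {u, v} \<in> E"
  by (auto simp: adj_def)

lemma supp_adj: "supp adj"
  using edge_in_V adj_edge unfolding supp_def by blast

lemma supp_cadj: "supp (cadj g)"
  using supp_adj by (auto simp: supp_def cadj_def)

lemma adj_sqrt_dg:
  assumes "u \<in> V"
  shows "(\<Sum>v\<in>V. adj u v * sqrt (dg v)) = sqrt (dg u)"
proof -
  have "(\<Sum>v\<in>V. adj u v * sqrt (dg v)) = (\<Sum>v\<in>V. of_bool ({u, v} \<in> E) / sqrt (dg u))"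
    by (intro sum.cong refl) (use dg_pos in \<open>force simp: adj_def\<close>)
  also have "\<dots> = dg u / sqrt (dg u)"
    by (simp only: dg_eq_sum[of u] sum_divide_distrib)
  also have "\<dots> = sqrt (dg u)"
    by (rule real_div_sqrt) (rule dg_nonneg)
  finally show ?thesis .
qed

lemma tr_adj_ge_1: "1 \<le> tr (mpow adj (2 * k))"
proof (rule tr_mpow_ge_1[OF supp_adj tp_adj adj_sqrt_dg])
  obtain u where "u \<in> V" using nonempty by blast
  show "0 < (\<Sum>v\<in>V. (sqrt (dg v))\<^sup>2)"
  proof (rule sum_pos2[OF fin \<open>u \<in> V\<close>])
    show "0 < (sqrt (dg u))\<^sup>2"
      using dg_pos[OF \<open>u \<in> V\<close>] by simp
  qed simp
qed

text \<open>In a proper colouring each colour class is a matching, so two consecutive steps of the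
  same colour return to the start.\<close>

lemma cadj_mult_cadj: "cadj g u v * cadj g v w = of_bool (u = w) * (cadj g u v)\<^sup>2"
proof (cases "u = w")
  case True
  then show ?thesis unfolding True cadj_sym[of g v w] power2_eq_square by simp
next
  case False
  have "cadj g u v = 0 \<or> cadj g v w = 0"
  proof (rule ccontr)
    assume "\<not> ?thesis"
    then have "adj u v \<noteq> 0" "adj v w \<noteq> 0" "c {u, v} = c {v, w}"
      by (simp_all add: cadj_def)
    then have "{u, v} \<in> E" "{v, w} \<in> E" "c {u, v} = c {v, w}"
      by (simp_all add: adj_edge)
    moreover have "{u, v} \<noteq> {v, w}" using False by (auto simp: doubleton_eq_iff)
    moreover have "{u, v} \<inter> {v, w} \<noteq> {}" by simp
    ultimately show False using proper unfolding proper_edge_coloring_def by metis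
  qed
  then show ?thesis using False by auto
qed

lemma sum_cadj_square: "(\<Sum>g\<in>c ` E. (cadj g u v)\<^sup>2) = (adj u v)\<^sup>2"
proof (cases "{u, v} \<in> E")
  case True
  have "(\<Sum>g\<in>c ` E. (cadj g u v)\<^sup>2) = (\<Sum>g\<in>c ` E. if g = c {u, v} then (adj u v)\<^sup>2 else 0)"
    by (intro sum.cong) (auto simp: cadj_def)
  then show ?thesis using True finite_E by simp
qed (simp add: cadj_def adj_def)

text \<open>In \<open>1 / (dg u * dg v)\<close> the degree of \<open>v\<close> is replaced by its
  lower bound \<open>D\<close>; the other factor cancels against the number of neighbours of
  \<open>u\<close>.\<close>

lemma sum_adj_square_le:
  assumes "u \<in> V"
  shows "(\<Sum>v\<in>V. (adj u v)\<^sup>2) \<le> 1 / D"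
proof -
  have "(\<Sum>v\<in>V. (adj u v)\<^sup>2) \<le> (\<Sum>v\<in>V. of_bool ({u, v} \<in> E) / (dg u * D))"
  proof (intro sum_mono)
    fix v assume "v \<in> V"
    have "(adj u v)\<^sup>2 = of_bool ({u, v} \<in> E) / (dg u * dg v)"
      by (simp add: adj_def power_divide power_mult_distrib dg_nonneg)
    also have "\<dots> \<le> of_bool ({u, v} \<in> E) / (dg u * D)"
      using dg_pos[OF assms] dg_ge[OF \<open>v \<in> V\<close>] dg_pos[OF \<open>v \<in> V\<close>] D_pos
      by (intro divide_left_mono mult_left_mono) auto
    finally show "(adj u v)\<^sup>2 \<le> of_bool ({u, v} \<in> E) / (dg u * D)" .
  qed
  also have "\<dots> = dg u / (dg u * D)"
    by (simp only: dg_eq_sum[of u] sum_divide_distrib)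
  also have "\<dots> = 1 / D"
    using dg_pos[OF assms] by simp
  finally show ?thesis .
qed

text \<open>The squares of the colour matrices are diagonal, so only the diagonal of
  \<open>P\<close> enters. Summed over colours, their entries are the row sums bounded by
  \<open>sum_adj_square_le\<close>.\<close>

lemma sum_tr_cadj_le:
  assumes "\<And>u. 0 \<le> P u u"
  shows "(\<Sum>g\<in>c ` E. tr (mm (mm (cadj g) (cadj g)) P)) \<le> tr P / D"
proof -
  have sq: "mm (cadj g) (cadj g) u w = of_bool (u = w) * (\<Sum>v\<in>V. (cadj g u v)\<^sup>2)" for g u w
    by (simp add: mm_def cadj_mult_cadj sum_distrib_left)
  have "tr (mm (mm (cadj g) (cadj g)) P) = (\<Sum>u\<in>V. (\<Sum>v\<in>V. (cadj g u v)\<^sup>2) * P u u)" for g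
  proof -
    have "(\<Sum>w\<in>V. mm (cadj g) (cadj g) u w * P w u) = (\<Sum>v\<in>V. (cadj g u v)\<^sup>2) * P u u"
      if "u \<in> V" for u
    proof -
      have "(\<Sum>w\<in>V. mm (cadj g) (cadj g) u w * P w u)
          = (\<Sum>w\<in>V. if w = u then (\<Sum>v\<in>V. (cadj g u v)\<^sup>2) * P u u else 0)"
        by (intro sum.cong) (auto simp: sq)
      then show ?thesis using that fin by simp
    qed
    then show ?thesis unfolding tr_def mm_def[of _ P] by simp
  qed
  then have "(\<Sum>g\<in>c ` E. tr (mm (mm (cadj g) (cadj g)) P))
      = (\<Sum>u\<in>V. \<Sum>g\<in>c ` E. (\<Sum>v\<in>V. (cadj g u v)\<^sup>2) * P u u)"
    by (simp only:) (rule sum.swap)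
  also have "\<dots> = (\<Sum>u\<in>V. (\<Sum>v\<in>V. (adj u v)\<^sup>2) * P u u)"
  proof (intro sum.cong refl)
    fix u
    show "(\<Sum>g\<in>c ` E. (\<Sum>v\<in>V. (cadj g u v)\<^sup>2) * P u u) = (\<Sum>v\<in>V. (adj u v)\<^sup>2) * P u u"
      unfolding sum_distrib_right[symmetric] by (subst sum.swap) (simp add: sum_cadj_square)
  qed
  also have "\<dots> \<le> (\<Sum>u\<in>V. 1 / D * P u u)"
    by (intro sum_mono mult_right_mono sum_adj_square_le assms)
  also have "\<dots> = tr P / D"
    by (simp add: tr_def sum_divide_distrib)
  finally show ?thesis .
qed

section \<open>Products with two steps of a prescribed colour\<close>

definition coloured_mats :: "nat \<Rightarrow> nat \<Rightarrow> 'c \<Rightarrow> nat \<Rightarrow> ('a \<Rightarrow> 'a \<Rightarrow> real) list" where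
  "coloured_mats i j g l =
     replicate i adj @ cadj g # replicate (j - i - 1) adj @ cadj g # replicate (l - j - 1) adj"

lemma length_coloured_mats:
  "i < j \<Longrightarrow> j < l \<Longrightarrow> length (coloured_mats i j g l) = l"
  by (simp add: coloured_mats_def)

text \<open>Consequently the weight of a walk is its \<open>adj\<close> weight if steps
  \<open>i\<close> and \<open>j\<close> both have colour \<open>g\<close>, and zero
  otherwise.\<close>

lemma nth_coloured_mats:
  assumes "i < j" "j < l" "t < l"
  shows "coloured_mats i j g l ! t = (if t = i \<or> t = j then cadj g else adj)"
proof -
  consider "t < i" | "t = i" | "i < t" "t < j" | "t = j" | "j < t" by linarith
  then show ?thesis
    using assms by cases (auto simp: coloured_mats_def nth_append nth_Cons')
qed

lemma tr_coloured_mats_le: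
  assumes "i < j" "j < 2 * Suc m"
  shows "tr (mprod (coloured_mats i j g (2 * Suc m)))
    \<le> tr (mm (mm (cadj g) (cadj g)) (mpow adj (2 * m)))"
proof -
  define b where "b = j - i - 1"
  define d where "d = 2 * Suc m - j - 1"
  have bd: "b + (d + i) = 2 * m" using assms by (simp add: b_def d_def)
  have "tr (mprod (coloured_mats i j g (2 * Suc m)))
      = tr (mm (mpow adj i) (mm (cadj g) (mm (mpow adj b) (mm (cadj g) (mpow adj d)))))"
    unfolding coloured_mats_def b_def[symmetric] d_def[symmetric] mpow_def
    by (subst mprod_append, (auto simp: supp_adj supp_cadj)[1])
      (simp, subst mprod_append, auto simp: supp_adj supp_cadj)
  \<comment> \<open>Cyclicity moves the leading power to the end; the two remaining exponents add up
    to \<open>2 * m\<close>.\<close>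
  also have "\<dots> = tr (mm (cadj g) (mm (mpow adj b) (mm (cadj g) (mpow adj (d + i)))))"
    by (subst tr_mm_commute) (simp add: mm_assoc mpow_add supp_adj)
  also have "\<dots> \<le> tr (mm (mm (cadj g) (cadj g)) (mpow adj (2 * m)))"
    by (rule tr_sandwich_le[OF supp_adj tp_adj supp_cadj tp_cadj bd])
  finally show ?thesis .
qed

definition rainbow_closed_walk :: "nat \<Rightarrow> (nat \<Rightarrow> 'a) \<Rightarrow> bool" where
  "rainbow_closed_walk l p \<longleftrightarrow> l \<ge> 1 \<and> p 0 = p l \<and> (\<forall>t<l. {p t, p (Suc t)} \<in> E)
     \<and> inj_on (\<lambda>t. c {p t, p (Suc t)}) {..<l}"

lemma wt_coloured_mats_nonneg:
  assumes "i < j" "j < l"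
  shows "0 \<le> wt (coloured_mats i j g l) vs"
  unfolding wt_def using assms
  by (intro prod_nonneg) (auto simp: length_coloured_mats nth_coloured_mats adj_nonneg cadj_nonneg)

definition colour_pairs :: "nat \<Rightarrow> (nat \<times> nat) set" where
  "colour_pairs l = {(i, j). i < j \<and> j < l}"

lemma finite_colour_pairs: "finite (colour_pairs l)"
  by (rule finite_subset[of _ "{..<l} \<times> {..<l}"]) (auto simp: colour_pairs_def)

lemma card_colour_pairs: "card (colour_pairs l) \<le> l\<^sup>2"
proof -
  have "card (colour_pairs l) \<le> card ({..<l} \<times> {..<l})"
    by (rule card_mono) (auto simp: colour_pairs_def)
  then show ?thesis by (simp add: power2_eq_square)
qed

text \<open>A closed walk of nonzero weight runs along edges and, not being rainbow, has two steps
  \<open>i < j\<close> of one colour \<open>g\<close>. The summand for these already equals its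
  weight, and the others are nonnegative.\<close>

lemma wt_le_sum_coloured:
  assumes no_rainbow: "\<And>p. \<not> rainbow_closed_walk l p"
    and l: "l \<ge> 1" and vs: "vs ! 0 = vs ! l"
  shows "wt (replicate l adj) vs
    \<le> (\<Sum>(i, j)\<in>colour_pairs l. \<Sum>g\<in>c ` E. wt (coloured_mats i j g l) vs)"
proof (cases "wt (replicate l adj) vs = 0")
  case True
  then show ?thesis
    by (auto intro!: sum_nonneg wt_coloured_mats_nonneg simp: colour_pairs_def)
next
  case False
  then have edges: "{vs ! t, vs ! Suc t} \<in> E" if "t < l" for t
    using that adj_edge by (auto simp: wt_def)
  then have "\<not> inj_on (\<lambda>t. c {vs ! t, vs ! Suc t}) {..<l}"
    using no_rainbow[of "\<lambda>t. vs ! t"] l vs by (auto simp: rainbow_closed_walk_def)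
  then obtain i j where ij: "i < j" "j < l"
      and col: "c {vs ! i, vs ! Suc i} = c {vs ! j, vs ! Suc j}"
    unfolding inj_on_def by (metis lessThan_iff linorder_neqE_nat)
  define g where "g = c {vs ! i, vs ! Suc i}"
  have "g \<in> c ` E"
    using edges[of i] ij by (simp add: g_def)
  have ij': "(i, j) \<in> colour_pairs l"
    using ij by (simp add: colour_pairs_def)
  have nonneg: "0 \<le> wt (coloured_mats i j g l) vs" if "(i, j) \<in> colour_pairs l" for i j g
    using that by (auto intro!: wt_coloured_mats_nonneg simp: colour_pairs_def)
  have "wt (replicate l adj) vs = wt (coloured_mats i j g l) vs"
    unfolding wt_def using ij col
    by (auto simp: length_coloured_mats nth_coloured_mats cadj_def g_def intro!: prod.cong)
  also have "\<dots> \<le> (\<Sum>g\<in>c ` E. wt (coloured_mats i j g l) vs)"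
    using \<open>g \<in> c ` E\<close> finite_E nonneg[OF ij'] by (intro member_le_sum) auto
  also have "\<dots> \<le> (\<Sum>(i, j)\<in>colour_pairs l. \<Sum>g\<in>c ` E. wt (coloured_mats i j g l) vs)"
    using member_le_sum[of "(i, j)" "colour_pairs l"
        "\<lambda>(i, j). \<Sum>g\<in>c ` E. wt (coloured_mats i j g l) vs"] ij' nonneg finite_colour_pairs
    by (auto intro!: sum_nonneg)
  finally show ?thesis .
qed

section \<open>The trace recursion\<close>

lemma tr_adj_step:
  assumes no_rainbow: "\<And>l p. \<not> rainbow_closed_walk l p"
  shows "tr (mpow adj (2 * Suc m)) \<le> (real (2 * Suc m))\<^sup>2 / D * tr (mpow adj (2 * m))"
proof -
  let ?l = "2 * Suc m"
  let ?P = "colour_pairs ?l"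
  let ?cl = "\<lambda>u vs. of_bool (last (u # vs) = u) :: real"
  have "tr (mpow adj ?l) = (\<Sum>u\<in>V. \<Sum>vs\<in>walks ?l. wt (replicate ?l adj) (u # vs) * ?cl u vs)"
    unfolding mpow_def tr_mprod_eq_sum_walks by simp
  also have "\<dots> \<le> (\<Sum>u\<in>V. \<Sum>vs\<in>walks ?l. \<Sum>(i, j)\<in>?P. \<Sum>g\<in>c ` E.
      wt (coloured_mats i j g ?l) (u # vs) * ?cl u vs)"
  proof (intro sum_mono)
    fix u vs assume "vs \<in> walks ?l"
    then have "length vs = ?l" by (simp add: walks_def)
    then have "last (u # vs) = (u # vs) ! ?l" by (subst last_conv_nth) auto
    then have "wt (replicate ?l adj) (u # vs) * ?cl u vs
        \<le> (\<Sum>(i, j)\<in>?P. \<Sum>g\<in>c ` E. wt (coloured_mats i j g ?l) (u # vs)) * ?cl u vs"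
      using wt_le_sum_coloured[OF no_rainbow, of ?l "u # vs"] by auto
    then show "wt (replicate ?l adj) (u # vs) * ?cl u vs
        \<le> (\<Sum>(i, j)\<in>?P. \<Sum>g\<in>c ` E. wt (coloured_mats i j g ?l) (u # vs) * ?cl u vs)"
      by (simp only: sum_distrib_right case_prod_unfold)
  qed
  \<comment> \<open>For fixed positions and colour, the sum over closed walks folds back into a
    trace.\<close>
  also have "\<dots> = (\<Sum>(i, j)\<in>?P. \<Sum>g\<in>c ` E. \<Sum>u\<in>V. \<Sum>vs\<in>walks ?l.
      wt (coloured_mats i j g ?l) (u # vs) * ?cl u vs)"
    unfolding case_prod_unfold by (rule sum_swap_pairs)
  also have "\<dots> = (\<Sum>(i, j)\<in>?P. \<Sum>g\<in>c ` E. tr (mprod (coloured_mats i j g ?l)))"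
    by (intro sum.cong refl)
      (auto simp: colour_pairs_def tr_mprod_eq_sum_walks length_coloured_mats)
  also have "\<dots> \<le> (\<Sum>(i, j)\<in>?P. \<Sum>g\<in>c ` E. tr (mm (mm (cadj g) (cadj g)) (mpow adj (2 * m))))"
    unfolding case_prod_unfold
    by (intro sum_mono tr_coloured_mats_le) (auto simp: colour_pairs_def)
  also have "\<dots> \<le> (\<Sum>(i, j)\<in>?P. tr (mpow adj (2 * m)) / D)"
    unfolding case_prod_unfold
    by (intro sum_mono sum_tr_cadj_le mpow_nonneg adj_nonneg)
  also have "\<dots> = real (card ?P) * (tr (mpow adj (2 * m)) / D)"
    by simp
  also have "\<dots> \<le> (real ?l)\<^sup>2 * (tr (mpow adj (2 * m)) / D)"
  proof (rule mult_right_mono)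
    show "real (card ?P) \<le> (real ?l)\<^sup>2"
      using card_colour_pairs by (metis of_nat_le_iff of_nat_power)
    show "0 \<le> tr (mpow adj (2 * m)) / D"
      using tr_adj_ge_1[of m] D_pos by simp
  qed
  finally show ?thesis by simp
qed

lemma exists_rainbow_closed_walk:
  assumes K: "real (card V) < 2 ^ K" and D: "8 * (real K)\<^sup>2 \<le> D"
  shows "\<exists>l p. rainbow_closed_walk l p"
proof (rule ccontr)
  assume "\<not> ?thesis"
  then have no_rainbow: "\<not> rainbow_closed_walk l p" for l p by blast
  have "tr (mpow adj (2 * k)) \<le> real (card V) / 2 ^ k" if "k \<le> K" for k
    using that
  proof (induction k)
    case 0
    show ?case by (simp add: tr_mI)
  next
    case (Suc k)
    \<comment> \<open>As \<open>Suc k\<close> is at most \<open>K\<close>, the factor in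
      \<open>tr_adj_step\<close> is at most \<open>4 * K^2 / D\<close>, hence at most one
      half.\<close>
    have "(real (2 * Suc k))\<^sup>2 \<le> 4 * (real K)\<^sup>2"
      using Suc.prems power_mono[of "real (2 * Suc k)" "2 * real K" 2]
      by (simp add: power_mult_distrib)
    then have "(real (2 * Suc k))\<^sup>2 / D \<le> 1 / 2"
      using D D_pos by (simp add: divide_simps)
    then have "(real (2 * Suc k))\<^sup>2 / D * tr (mpow adj (2 * k)) \<le> 1 / 2 * tr (mpow adj (2 * k))"
      using tr_adj_ge_1[of k] by (intro mult_right_mono) auto
    then have "tr (mpow adj (2 * Suc k)) \<le> 1 / 2 * tr (mpow adj (2 * k))"
      using tr_adj_step[OF no_rainbow, of k] by linarith
    also have "\<dots> \<le> 1 / 2 * (real (card V) / 2 ^ k)"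
      using Suc by (intro mult_left_mono) auto
    finally show ?case by simp
  qed
  from this[of K] have "tr (mpow adj (2 * K)) < 1"
    using K by (simp add: order_le_less_trans divide_less_eq)
  then show False using tr_adj_ge_1[of K] by simp
qed

lemma rainbow_cycle_of_closed_walk:
  assumes "rainbow_closed_walk l p"
  shows "\<exists>vs. is_cycle E vs \<and> rainbow c (cycle_edges vs)"
proof -
  have l: "l \<ge> 1" "p 0 = p l" and edges: "\<And>t. t < l \<Longrightarrow> {p t, p (Suc t)} \<in> E"
    and inj: "inj_on (\<lambda>t. c {p t, p (Suc t)}) {..<l}"
    using assms by (auto simp: rainbow_closed_walk_def)
  \<comment> \<open>\<open>Q m\<close> says that some segment of \<open>m\<close> steps is closed;
    the least such \<open>m\<close> gives the cycle.\<close>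
  define Q where "Q m \<longleftrightarrow> (\<exists>i. m \<ge> 1 \<and> i + m \<le> l \<and> p i = p (i + m))" for m
  define m where "m = (LEAST m. Q m)"
  have "Q l" using l by (auto simp: Q_def)
  then have "Q m" unfolding m_def by (rule LeastI)
  then obtain i where i: "m \<ge> 1" "i + m \<le> l" "p i = p (i + m)" by (auto simp: Q_def)
  have min: "\<not> Q k" if "k < m" for k
    using that not_less_Least unfolding m_def by blast
  have "m \<noteq> 1"
  proof
    assume "m = 1"
    then have "{p i} \<in> E" using edges[of i] i by simp
    then show False using simple by (auto simp: simple_graph_def)
  qed
  \<comment> \<open>A closed segment of two steps would traverse one edge twice and so repeat its
    colour.\<close>
  moreover have "m \<noteq> 2"
  proof
    assume "m = 2"
    then have "{p i, p (Suc i)} = {p (Suc i), p (Suc (Suc i))}"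
      using i by (auto simp: numeral_2_eq_2)
    then have "i = Suc i"
      using inj_onD[OF inj, of i "Suc i"] i \<open>m = 2\<close> by simp
    then show False by simp
  qed
  ultimately have "m \<ge> 3" using i(1) by linarith
  define vs where "vs = map p [i..<i + m]"
  have len: "length vs = m" by (simp add: vs_def)
  have nth: "vs ! t = p (i + t)" if "t < m" for t
    using that by (simp add: vs_def)
  have "distinct vs"
    unfolding distinct_conv_nth
  proof (intro allI impI)
    fix s t assume "s < length vs" "t < length vs" "s \<noteq> t"
    then have st: "s < m" "t < m" "s \<noteq> t" by (simp_all add: len)
    \<comment> \<open>A repeated vertex would cut out a shorter closed segment.\<close>
    have no_rep: "p (i + s) \<noteq> p (i + t)" if "s < t" "t < m" for s t
    proof
      assume eq: "p (i + s) = p (i + t)"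
      then have "Q (t - s)" unfolding Q_def
        using that i by (intro exI[of _ "i + s"]) auto
      then show False using min[of "t - s"] that by auto
    qed
    show "vs ! s \<noteq> vs ! t"
      using st no_rep[of s t] no_rep[of t s] by (cases s t rule: linorder_cases) (auto simp: nth)
  qed
  \<comment> \<open>At \<open>t = m - 1\<close> the cyclic index wraps to \<open>0\<close>, which
    agrees with the walk because \<open>p i = p (i + m)\<close>.\<close>
  have edge: "{vs ! t, vs ! (Suc t mod length vs)} = {p (i + t), p (Suc (i + t))}" if "t < m" for t
  proof (cases "Suc t = m")
    case True
    then show ?thesis using i that nth[of 0] nth[of t] by (auto simp: len)
  next
    case False
    then show ?thesis using that by (simp add: len nth)
  qed
  have ce: "cycle_edges vs = (\<lambda>t. {p (i + t), p (Suc (i + t))}) ` {..<m}"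
    unfolding cycle_edges_def using edge by (auto simp: len image_iff)
  have "is_cycle E vs"
    unfolding is_cycle_def ce using \<open>m \<ge> 3\<close> \<open>distinct vs\<close> i edges by (auto simp: len)
  moreover have "inj_on c (cycle_edges vs)"
  proof (rule inj_onI)
    fix e f assume "e \<in> cycle_edges vs" "f \<in> cycle_edges vs" and eq: "c e = c f"
    then obtain s t where st: "s < m" "t < m"
      "e = {p (i + s), p (Suc (i + s))}" "f = {p (i + t), p (Suc (i + t))}"
      unfolding ce by blast
    then have "i + s = i + t"
      using inj_onD[OF inj, of "i + s" "i + t"] eq i by simp
    then show "e = f" using st by simp
  qed
  ultimately show ?thesis unfolding rainbow_def by blast
qed

end

subsection \<open>Passing to a subgraph of large minimum degree\<close>

text \<open>Deleting a vertex of degree below \<open>D\<close> costs fewer than \<open>D\<close>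
  edges and one vertex, so the density bound survives and induction on the number of vertices
  applies.\<close>

lemma exists_min_degree_subgraph:
  fixes D :: real
  assumes "simple_graph V E" "V \<noteq> {}" "D > 0" "D * card V \<le> card E"
  shows "\<exists>W F. W \<subseteq> V \<and> F \<subseteq> E \<and> W \<noteq> {} \<and> simple_graph W F
    \<and> (\<forall>v\<in>W. D \<le> card {w. {v, w} \<in> F})"
  using assms
proof (induction "card V" arbitrary: V E rule: less_induct)
  case less
  have finV: "finite V" and EV: "\<And>e. e \<in> E \<Longrightarrow> e \<subseteq> V \<and> card e = 2"
    using less.prems(1) by (auto simp: simple_graph_def)
  have finE: "finite E"
    using finV EV finite_subset[of E "Pow V"] by auto
  show ?case
  proof (cases "\<forall>v\<in>V. D \<le> card {w. {v, w} \<in> E}")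
    case True
    then show ?thesis using less.prems by blast
  next
    case False
    then obtain v where v: "v \<in> V" "card {w. {v, w} \<in> E} < D" by force
    define F where "F = {e \<in> E. v \<notin> e}"
    have star: "E - F = (\<lambda>w. {v, w}) ` {w. {v, w} \<in> E}"
    proof (intro equalityI subsetI)
      fix e assume e: "e \<in> E - F"
      then have "v \<in> e" "card e = 2" using EV by (auto simp: F_def)
      then obtain w where "e = {v, w}" by (auto simp: card_2_iff)
      then show "e \<in> (\<lambda>w. {v, w}) ` {w. {v, w} \<in> E}" using e by auto
    qed (auto simp: F_def)
    have "finite {w. {v, w} \<in> E}"
      using finV EV by (auto intro: finite_subset[of _ V])
    then have "card (E - F) \<le> card {w. {v, w} \<in> E}"
      unfolding star by (rule card_image_le)
    moreover have "card E = card F + card (E - F)"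
      using finE by (subst card_Diff_subset) (auto simp: F_def card_mono intro: finite_subset[of _ E])
    ultimately have F: "card E < card F + D" using v(2) by linarith
    have cV: "card V = Suc (card (V - {v}))"
      using finV v(1) by (metis card_Suc_Diff1)
    have simpleF: "simple_graph (V - {v}) F"
      using finV EV by (auto simp: simple_graph_def F_def)
    have dF: "D * card (V - {v}) < card F"
      using F less.prems(4) by (simp add: cV algebra_simps)
    \<comment> \<open>The strict inequality \<open>dF\<close> leaves at least one edge, hence a
      vertex.\<close>
    have "V - {v} \<noteq> {}"
    proof
      assume *: "V - {v} = {}"
      have "e \<notin> F" for e
      proof
        assume "e \<in> F"
        then have "e \<subseteq> {}" "card e = 2"
          using simpleF * by (auto simp: simple_graph_def)
        then show False by simp
      qed
      then have "F = {}" by blast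
      then show False using dF unfolding * by simp
    qed
    then have "\<exists>W H. W \<subseteq> V - {v} \<and> H \<subseteq> F \<and> W \<noteq> {} \<and> simple_graph W H
        \<and> (\<forall>v\<in>W. D \<le> card {w. {v, w} \<in> H})"
      using less.hyps[OF _ simpleF _ less.prems(3)] dF cV by simp
    then obtain W H where "W \<subseteq> V - {v}" "H \<subseteq> F" "W \<noteq> {}" "simple_graph W H"
      "\<forall>v\<in>W. D \<le> card {w. {v, w} \<in> H}" by blast
    then show ?thesis by (intro exI[of _ W] exI[of _ H]) (auto simp: F_def)
  qed
qed

theorem theorem1p1:
  fixes V :: "'a set" and E :: "'a set set" and c :: "'a set \<Rightarrow> 'c" and n :: nat
  assumes "simple_graph V E"
    and "card V = n" and "n \<ge> 1"
    and "proper_edge_coloring E c"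
    and "real (card E) \<ge> 32 * real n * (log 2 (5 * real n))\<^sup>2"
  shows "\<exists>vs. is_cycle E vs \<and> rainbow c (cycle_edges vs)"
proof -
  define L where "L = log 2 (5 * real n)"
  define D where "D = 32 * L\<^sup>2"
  \<comment> \<open>Splitting \<open>5 * n\<close> as \<open>2 * (5 / 2 * n)\<close> frees the
    \<open>1\<close> that absorbs the rounding in \<open>K\<close>.\<close>
  have L: "L = log 2 (5 / 2 * real n) + 1"
    unfolding L_def using log_mult[of 2 2 "5 / 2 * real n"] assms(3) by simp
  have "log 2 (real n) \<ge> 0" using assms(3) by simp
  have le: "log 2 (real n) + 1 \<le> L"
    unfolding L using assms(3) by simp
  then have "L > 0" using \<open>log 2 (real n) \<ge> 0\<close> by linarith
  then have "D > 0" by (simp add: D_def)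
  have "V \<noteq> {}" using assms(2,3) by auto
  moreover have "D * card V \<le> card E"
    using assms(2,5) by (simp add: D_def L_def mult_ac)
  ultimately obtain W F where W: "W \<subseteq> V" "F \<subseteq> E" "W \<noteq> {}" "simple_graph W F"
      and deg: "\<And>v. v \<in> W \<Longrightarrow> D \<le> card {w. {v, w} \<in> F}"
    using exists_min_degree_subgraph[OF assms(1) _ \<open>D > 0\<close>] by blast
  \<comment> \<open>The least natural number above \<open>log 2 n\<close>: large enough for
    \<open>2 ^ K\<close> to exceed \<open>n\<close>, yet at most \<open>L\<close>, so
    \<open>8 * K^2\<close> stays below \<open>D\<close>.\<close>
  define K where "K = Suc (nat \<lfloor>log 2 (real n)\<rfloor>)"
  have K_le: "real K \<le> L"
    using le \<open>log 2 (real n) \<ge> 0\<close> unfolding K_def by linarith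
  have "log 2 (real n) < real K"
    using \<open>log 2 (real n) \<ge> 0\<close> unfolding K_def by linarith
  then have "real n < 2 ^ K"
    using assms(3) by (simp add: log_less_iff powr_realpow)
  moreover have "card W \<le> n"
    using W(1) assms(1,2) by (auto simp: simple_graph_def intro: card_mono)
  ultimately have cW: "real (card W) < 2 ^ K" by linarith
  have KD: "8 * (real K)\<^sup>2 \<le> D"
    using power_mono[OF K_le, of 2] zero_le_power2[of L] unfolding D_def by linarith
  interpret min_degree_graph W F c D
  proof
    show "finite W" using W(4) by (simp add: simple_graph_def)
    show "proper_edge_coloring F c"
      using assms(4) W(2) unfolding proper_edge_coloring_def by blast
  qed (use W deg \<open>D > 0\<close> in auto)
  from exists_rainbow_closed_walk[OF cW KD] obtain vs
    where "is_cycle F vs" "rainbow c (cycle_edges vs)"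
    using rainbow_cycle_of_closed_walk by blast
  then show ?thesis using W(2) unfolding is_cycle_def by blast
qed

end
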